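(* Let $n\ge 2$ and let $(s_1, s_2, \dots, s_{n-1}, p)\in \mathbb{C}^n$ with $|p|<1$. Then the following are equivalent. (i) $(s_1, s_2, \dots, s_{n-1}, p)\in \mathbb{G}_n$. (ii) There exists $(\beta_1, \dots, \beta_{n-1})\in \mathbb{G}_{n-1}$ such that $s_j=\beta_j+\overline{\beta_{n-j}}\,p$ for $j=1, \dots, n-1$. (iii) The $n\times n$ Hermitian matrix $M=(M_{kl})_{k,l=1}^n$ is positive definite, where, with $a_0=1$, $a_j=(-1)^j s_j$ for $1\le j\le n-1$, and $a_n=(-1)^n p$, \[ M_{kl}=\sum_{j=1}^{\min(k,l)}\left(\overline{a_{k-j}}\,a_{l-j}-a_{n-k+j}\,\overline{a_{n-l+j}}\right),\] that is, \[ M=\begin{bmatrix} 1-|p|^2 & -s_1+\overline{s_{n-1}}p& \dots & (-1)^{n-1}s_{n-1}+ (-1)^n \overline{s_1} p \\ -\overline{s_1} + s_{n-1}\overline{p} & 1+|s_1|^2-|s_{n-1}|^2-|p|^2 & \dots& (-1)^{n-2}s_{n-2}+(-1)^{n-1}\overline{s_2}p\\ \vdots & \vdots &\dots & \vdots \\ (-1)^{n-1}\overline{s_{n-1}}+(-1)^ns_1\overline{p} & (-1)^{n-2}\overline{s_{n-2}}+(-1)^{n-1}s_2\overline{p} & \dots & 1-|p|^2 \end{bmatrix} \] (the displayed form is schematic; for small $n$, the formula for $M_{kl}$ defines $M$).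
   Context: Let $\mathbb{D}=\{z\in\mathbb{C}:|z|<1\}$. For $n\ge 2$, the symmetrization map $\pi_n:\mathbb{C}^n\to\mathbb{C}^n$ is $\pi_n(z_1,\dots,z_n)=(e_1,\dots,e_n)$, where $e_k=\sum_{1\le i_1<\dots<i_k\le n} z_{i_1}\cdots z_{i_k}$ is the $k$-th elementary symmetric polynomial in $z_1,\dots,z_n$. Set $\mathbb{G}_n=\{\pi_n(\boldsymbol{z}):\boldsymbol{z}\in\mathbb{D}^n\}$ for $n\ge2$, and $\mathbb{G}_1=\mathbb{D}$. *)

theory Defs
  imports "Jordan_Normal_Form.Schur_Decomposition"
begin

text \<open>
  Points of $\mathbb{C}^n$ are elements of \<^term>\<open>carrier_vec n :: complex vec set\<close>. Vector and matrix
  indices start at 0, so the mathematical coordinate $z_j$ is \<^term>\<open>z $ (j - 1)\<close>.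
\<close>

definition elem_sym :: "complex vec \<Rightarrow> nat \<Rightarrow> complex" where
  "elem_sym z k = (\<Sum>I | I \<subseteq> {0..<dim_vec z} \<and> card I = k. \<Prod>i\<in>I. z $ i)"

definition symmetrization :: "nat \<Rightarrow> complex vec \<Rightarrow> complex vec" where
  "symmetrization n z = vec n (\<lambda>i. elem_sym z (i + 1))"

definition polydisc :: "nat \<Rightarrow> complex vec set" where
  "polydisc n = {z \<in> carrier_vec n. \<forall>i<n. cmod (z $ i) < 1}"

definition sym_polydisc :: "nat \<Rightarrow> complex vec set" (\<open>\<G>\<close>) where
  "\<G> n = symmetrization n ` polydisc n"

text \<open>
  The symmetrization map in one variable is the identity, so \<^term>\<open>\<G> 1\<close> is the unit disc.
\<close>

lemma sym_polydisc_1: "\<G> 1 = {z \<in> carrier_vec 1. cmod (z $ 0) < 1}"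
proof -
  have "symmetrization 1 z = z" if "z \<in> carrier_vec 1" for z
  proof -
    from that have d: "dim_vec z = 1" by simp
    have "{I. I \<subseteq> {0..<dim_vec z} \<and> card I = 1} = {{0::nat}}"
      by (auto simp: d card_1_singleton_iff)
    then have "elem_sym z 1 = z $ 0"
      unfolding elem_sym_def by simp
    with d show ?thesis
      unfolding symmetrization_def by (intro eq_vecI) auto
  qed
  then have "\<G> 1 = polydisc 1"
    unfolding sym_polydisc_def by (auto simp: polydisc_def image_iff)
  then show ?thesis
    by (auto simp: polydisc_def)
qed

text \<open>
  The order on \<^typ>\<open>complex\<close> is the one of \<^theory>\<open>HOL-Library.Complex_Order\<close>: \<^term>\<open>0 < (z :: complex)\<close>
  says that \<^term>\<open>z\<close> is real and positive.
\<close>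

definition pos_def_mat :: "nat \<Rightarrow> complex mat \<Rightarrow> bool" where
  "pos_def_mat n A \<longleftrightarrow> A \<in> carrier_mat n n \<and> mat_adjoint A = A \<and>
     (\<forall>v \<in> carrier_vec n. v \<noteq> 0\<^sub>v n \<longrightarrow> 0 < (A *\<^sub>v v) \<bullet>c v)"

definition signed_coeff :: "nat \<Rightarrow> complex vec \<Rightarrow> complex \<Rightarrow> nat \<Rightarrow> complex" where
  "signed_coeff n s p j =
     (if j = 0 then 1 else if j = n then (-1) ^ n * p else (-1) ^ j * s $ (j - 1))"

text \<open>Here \<open>k\<close> and \<open>l\<close> range over $1, \dots, n$; the shift to 0-based indices happens in the matrix.\<close>

definition schur_cohn_entry :: "nat \<Rightarrow> complex vec \<Rightarrow> complex \<Rightarrow> nat \<Rightarrow> nat \<Rightarrow> complex" where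
  "schur_cohn_entry n s p k l =
     (let a = signed_coeff n s p in
       \<Sum>j = 1..min k l. cnj (a (k - j)) * a (l - j) - a (n - k + j) * cnj (a (n - l + j)))"

definition schur_cohn_mat :: "nat \<Rightarrow> complex vec \<Rightarrow> complex \<Rightarrow> complex mat" where
  "schur_cohn_mat n s p = mat n n (\<lambda>(k, l). schur_cohn_entry n s p (k + 1) (l + 1))"

lemma schur_cohn_mat_hermitian: "mat_adjoint (schur_cohn_mat n s p) = schur_cohn_mat n s p"
proof (rule eq_matI)
  fix i j assume "i < dim_row (schur_cohn_mat n s p)" "j < dim_col (schur_cohn_mat n s p)"
  then have "i < n" "j < n" by (simp_all add: schur_cohn_mat_def)
  then show "mat_adjoint (schur_cohn_mat n s p) $$ (i, j) = schur_cohn_mat n s p $$ (i, j)"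
    by (simp add: mat_adjoint_def schur_cohn_mat_def mat_of_rows_def schur_cohn_entry_def Let_def
        min.commute mult.commute cnj_sum)
qed (simp_all add: mat_adjoint_def schur_cohn_mat_def)

end

theory Submission
  imports Defs
begin

text \<open>
  Write $P(x) = \sum_j a_j x^{n-j}$ with $a_0 = 1$. Then (i) says that all zeros of $P$ lie in the open
  unit disc. Everything rests on one Schur reduction step $a_j = b_j + a_n \overline{b_{n-j}}$, that is
  $P = x R + a_n R^*$ with $R$ monic of degree $n - 1$ and $R^*(x) = x^{n-1}\,\overline{R(1/\bar x)}$.

  If $R$ has all zeros in the disc, then $|R^*| \le |R|$ outside it, so $P$ does not vanish there;
  since $(1 - |a_n|^2)\, x R = P - a_n P^*$, the converse is the same argument. This is (i) iff (ii).

  For (iii), the Hermitian form of $M$ is $\|P^\sharp(S) v\|^2 - \|P^\flat(S) v\|^2$ where $S$ is the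
  truncated shift and $P^\sharp$, $P^\flat$ have coefficients $a_j$ and $\overline{a_{n-j}}$. Under the
  reduction step it becomes $1 - |a_n|^2$ times the sum of $|v_1 + b_1 v_2 + \dots + b_{n-1} v_n|^2$ and the
  form of $R$ at $(v_2, \dots, v_n)$, so definiteness is inherited in both directions, and one inducts on $n$.
\<close>

section \<open>Polynomials with all zeros in the disc\<close>

text \<open>Coefficients run from the top degree down, matching the indexing of the
  \<open>a_j\<close>; thus \<open>a 0 = 1\<close> says that the polynomial is monic.\<close>

definition desc_poly :: "nat \<Rightarrow> (nat \<Rightarrow> complex) \<Rightarrow> complex \<Rightarrow> complex" where
  "desc_poly n a x = (\<Sum>j\<le>n. a j * x ^ (n - j))"

definition conj_rev_poly :: "nat \<Rightarrow> (nat \<Rightarrow> complex) \<Rightarrow> complex \<Rightarrow> complex" where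
  "conj_rev_poly n a x = (\<Sum>j\<le>n. cnj (a j) * x ^ j)"

definition schur_stable :: "nat \<Rightarrow> (nat \<Rightarrow> complex) \<Rightarrow> bool" where
  "schur_stable n a \<longleftrightarrow> (\<forall>x. 1 \<le> cmod x \<longrightarrow> desc_poly n a x \<noteq> 0)"

lemma desc_poly_cong: "(\<And>j. j \<le> n \<Longrightarrow> a j = b j) \<Longrightarrow> desc_poly n a = desc_poly n b"
  by (auto simp: desc_poly_def fun_eq_iff)

text \<open>Over an infinite field a polynomial function determines its coefficients; the proof
  passes to the type \<open>poly\<close> to use this.\<close>

lemma desc_poly_eqD:
  assumes "desc_poly n a = desc_poly n b" and "j \<le> n"
  shows "a j = b j"
proof -
  define P where "P c = (\<Sum>j\<le>n. Polynomial.monom (c j :: complex) (n - j))" for c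
  have "poly (P c) = desc_poly n c" for c
    by (auto simp: P_def desc_poly_def fun_eq_iff poly_sum poly_monom)
  then have "P a = P b"
    using assms(1) by (metis poly_eq_poly_eq_iff)
  moreover have "Polynomial.coeff (P c) (n - j) = c j" for c
  proof -
    have "Polynomial.coeff (P c) (n - j) = (\<Sum>i\<le>n. if i = j then c i else 0)"
      unfolding P_def coeff_sum coeff_monom using assms(2) by (intro sum.cong) auto
    then show ?thesis using assms(2) by simp
  qed
  ultimately show ?thesis by metis
qed

lemma desc_poly_factorization:
  assumes "a 0 = 1"
  shows "\<exists>z. \<forall>x. desc_poly n a x = (\<Prod>i<n. x - z i)"
proof -
  define P where "P = (\<Sum>j\<le>n. Polynomial.monom (a j) (n - j))"
  have poly_P: "poly P x = desc_poly n a x" for x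
    by (simp add: P_def desc_poly_def poly_sum poly_monom)
  \<comment> \<open>Among the indices \<open>j \<le> n\<close> only \<open>j = 0\<close> has
    \<open>n - j = n\<close>, so the top coefficient is \<open>a 0\<close>.\<close>
  have "Polynomial.coeff P n = (\<Sum>j\<le>n. if j = 0 then a j else 0)"
    unfolding P_def coeff_sum coeff_monom by (intro sum.cong) auto
  then have lead: "Polynomial.coeff P n = 1" using assms by simp
  have "degree P \<le> n"
    unfolding P_def by (intro degree_sum_le) (auto intro: order.trans[OF degree_monom_le])
  with lead have deg: "degree P = n" by (metis le_antisym le_degree zero_neq_one)
  obtain as where as: "Polynomial.smult (Polynomial.coeff P (degree P)) (\<Prod>a\<leftarrow>as. [:- a, 1:]) = P"
    "length as = degree P"
    using fundamental_theorem_algebra_factorized[of P] by blast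
  have "desc_poly n a x = (\<Prod>i<n. x - as ! i)" for x
  proof -
    have "desc_poly n a x = poly (\<Prod>a\<leftarrow>as. [:- a, 1:]) x"
      using as lead by (simp add: poly_P deg)
    also have "\<dots> = (\<Prod>a\<leftarrow>as. x - a)"
      by (simp add: poly_prod_list o_def)
    also have "\<dots> = (\<Prod>i<n. x - as ! i)"
      using as(2) by (simp add: prod.list_conv_set_nth deg atLeast0LessThan)
    finally show ?thesis .
  qed
  then show ?thesis by (intro exI[of _ "(!) as"]) simp
qed

lemma schur_stable_factorization:
  assumes "a 0 = 1" and "schur_stable n a"
  obtains z where "\<And>x. desc_poly n a x = (\<Prod>i<n. x - z i)" and "\<And>i. i < n \<Longrightarrow> cmod (z i) < 1"
proof -
  obtain z where z: "\<And>x. desc_poly n a x = (\<Prod>i<n. x - z i)"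
    using desc_poly_factorization[of a n, OF assms(1)] by blast
  have "cmod (z i) < 1" if "i < n" for i
  proof -
    have "desc_poly n a (z i) = 0" using that by (auto simp: z)
    then show ?thesis using assms(2) unfolding schur_stable_def by force
  qed
  with z show ?thesis using that by blast
qed

text \<open>Vieta: expand the product over the sets \<open>X\<close> of factors that contribute
  \<open>- z $ i\<close>, then group these sets by cardinality.\<close>

lemma prod_linear_eq_desc_poly:
  fixes z :: "complex Matrix.vec"
  assumes "z \<in> carrier_vec n"
  shows "(\<Prod>i<n. x - z $ i) = desc_poly n (\<lambda>k. (-1) ^ k * elem_sym z k) x"
proof -
  have "(\<Prod>i<n. x - z $ i) =
      (\<Sum>X\<in>Pow {..<n}. (-1) ^ card X * (\<Prod>i\<in>X. z $ i) * x ^ card ({..<n} - X))"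
    by (simp add: prod_diff_conv_sum)
  also have "\<dots> = (\<Sum>X\<in>Pow {..<n}. (-1) ^ card X * (\<Prod>i\<in>X. z $ i) * x ^ (n - card X))"
    by (intro sum.cong refl) (auto simp: card_Diff_subset finite_subset)
  also have "\<dots> = (\<Sum>k\<in>{..n}. \<Sum>X\<in>{X\<in>Pow {..<n}. card X = k}.
      (-1) ^ card X * (\<Prod>i\<in>X. z $ i) * x ^ (n - card X))"
    by (subst sum.group) (auto intro: order.trans[OF card_mono[of "{..<n}"]])
  also have "\<dots> = desc_poly n (\<lambda>k. (-1) ^ k * elem_sym z k) x"
    using assms unfolding desc_poly_def elem_sym_def
    by (intro sum.cong refl) (auto simp: sum_distrib_left sum_distrib_right lessThan_atLeast0 intro!: sum.cong)
  finally show ?thesis .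
qed

lemma elem_sym_0 [simp]: "elem_sym z 0 = 1"
proof -
  have "{I. I \<subseteq> {0..<dim_vec z} \<and> card I = 0} = {{}}"
    by (auto dest: finite_subset)
  then show ?thesis unfolding elem_sym_def by simp
qed

text \<open>By Vieta, a preimage of \<open>w\<close> under symmetrization is a list of the zeros of
  the monic polynomial with signed coefficients \<open>w\<close>. This serves both dimensions in the
  theorem, \<open>n\<close> and \<open>n - 1\<close>.\<close>

lemma mem_sym_polydisc_iff:
  assumes w: "w \<in> carrier_vec n" and "a 0 = 1" and a: "\<And>j. j < n \<Longrightarrow> a (Suc j) = (-1) ^ Suc j * w $ j"
  shows "w \<in> \<G> n \<longleftrightarrow> schur_stable n a"
proof
  assume "w \<in> \<G> n"
  then obtain z where z: "z \<in> carrier_vec n" "\<And>i. i < n \<Longrightarrow> cmod (z $ i) < 1"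
    and wz: "w = symmetrization n z"
    by (auto simp: sym_polydisc_def polydisc_def)
  have "a j = (-1) ^ j * elem_sym z j" if "j \<le> n" for j
    using that assms(2) a by (cases j) (auto simp: wz symmetrization_def)
  then have "desc_poly n a = desc_poly n (\<lambda>k. (-1) ^ k * elem_sym z k)"
    by (rule desc_poly_cong)
  then have prod: "desc_poly n a x = (\<Prod>i<n. x - z $ i)" for x
    by (simp add: prod_linear_eq_desc_poly[OF z(1)])
  show "schur_stable n a"
    unfolding schur_stable_def
  proof (intro allI impI)
    fix x assume "1 \<le> cmod x"
    then have "x \<noteq> z $ i" if "i < n" for i using z(2)[OF that] by auto
    then show "desc_poly n a x \<noteq> 0" by (simp add: prod)
  qed
next
  assume "schur_stable n a"
  then obtain z where z: "\<And>x. desc_poly n a x = (\<Prod>i<n. x - z i)" "\<And>i. i < n \<Longrightarrow> cmod (z i) < 1"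
    using schur_stable_factorization assms(2) by blast
  \<comment> \<open>The zeros, collected in a vector, are the preimage of \<open>w\<close>;
    comparing coefficients confirms it.\<close>
  define y where "y = Matrix.vec n z"
  have "desc_poly n a = desc_poly n (\<lambda>k. (-1) ^ k * elem_sym y k)"
    using prod_linear_eq_desc_poly[of y n] by (auto simp: y_def z fun_eq_iff)
  from desc_poly_eqD[OF this] have "a (Suc j) = (-1) ^ Suc j * elem_sym y (Suc j)" if "j < n" for j
    using that by simp
  then have "w $ j = elem_sym y (Suc j)" if "j < n" for j
    using a that by fastforce
  then have "w = symmetrization n y"
    using w by (intro eq_vecI) (auto simp: symmetrization_def)
  moreover have "y \<in> polydisc n" using z(2) by (auto simp: y_def polydisc_def)
  ultimately show "w \<in> \<G> n" by (auto simp: sym_polydisc_def)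
qed

section \<open>The Schur reduction step\<close>

lemma conj_rev_poly_eq:
  assumes "x \<noteq> 0"
  shows "conj_rev_poly n a x = x ^ n * cnj (desc_poly n a (1 / cnj x))"
  unfolding conj_rev_poly_def desc_poly_def cnj_sum sum_distrib_left
proof (intro sum.cong refl)
  fix j assume "j \<in> {..n}"
  then have "x ^ n = x ^ j * x ^ (n - j)" by (simp flip: power_add)
  then show "cnj (a j) * x ^ j = x ^ n * cnj (a j * (1 / cnj x) ^ (n - j))"
    using assms by (simp add: power_divide)
qed

text \<open>This bounds the inverse of a Blaschke factor: the difference of the squared moduli
  factors into two nonnegative terms.\<close>

lemma norm_one_minus_cnj_mult_le:
  assumes "cmod z \<le> 1" and "1 \<le> cmod x"
  shows "cmod (1 - cnj z * x) \<le> cmod (x - z)"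
proof -
  have "(cmod (x - z))\<^sup>2 - (cmod (1 - cnj z * x))\<^sup>2 = ((cmod x)\<^sup>2 - 1) * (1 - (cmod z)\<^sup>2)"
    by (simp add: cmod_power2) (simp add: power2_eq_square algebra_simps)
  also have "\<dots> \<ge> 0" using assms by (simp add: abs_square_le_1)
  finally have "(cmod (1 - cnj z * x))\<^sup>2 \<le> (cmod (x - z))\<^sup>2" by simp
  then show ?thesis by (rule power2_le_imp_le) simp
qed

text \<open>Distributing \<open>x ^ n\<close> over the \<open>n\<close> reflected linear factors
  turns each into \<open>1 - cnj (z i) * x\<close>, which the Blaschke estimate compares with
  \<open>x - z i\<close>.\<close>

lemma norm_conj_rev_poly_le:
  assumes "a 0 = 1" "schur_stable n a" "1 \<le> cmod x"
  shows "cmod (conj_rev_poly n a x) \<le> cmod (desc_poly n a x)"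
proof -
  obtain z where z: "\<And>x. desc_poly n a x = (\<Prod>i<n. x - z i)" "\<And>i. i < n \<Longrightarrow> cmod (z i) < 1"
    using schur_stable_factorization assms by blast
  have "x \<noteq> 0" using assms(3) by auto
  then have "conj_rev_poly n a x = (\<Prod>i<n. x * (1 / x - cnj (z i)))"
    by (simp add: conj_rev_poly_eq z prod.distrib)
  also have "\<dots> = (\<Prod>i<n. 1 - cnj (z i) * x)"
    using \<open>x \<noteq> 0\<close> by (intro prod.cong refl) (simp add: field_simps)
  finally have "cmod (conj_rev_poly n a x) = (\<Prod>i<n. cmod (1 - cnj (z i) * x))"
    by (simp add: prod_norm)
  also have "\<dots> \<le> (\<Prod>i<n. cmod (x - z i))"
    using z(2) assms(3) by (intro prod_mono) (auto simp: norm_one_minus_cnj_mult_le less_imp_le)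
  finally show ?thesis by (simp add: z prod_norm)
qed

lemma schur_stable_last:
  assumes "a 0 = 1" "schur_stable (Suc m) a"
  shows "cmod (a (Suc m)) < 1"
proof -
  obtain z where z: "\<And>x. desc_poly (Suc m) a x = (\<Prod>i<Suc m. x - z i)"
    "\<And>i. i < Suc m \<Longrightarrow> cmod (z i) < 1"
    using schur_stable_factorization assms by blast
  have "a (Suc m) = desc_poly (Suc m) a 0"
    by (simp add: desc_poly_def Suc_diff_le)
  then have "cmod (a (Suc m)) = (\<Prod>i<m. cmod (z i)) * cmod (z m)"
    by (simp add: z norm_mult flip: prod_norm)
  \<comment> \<open>One zero is kept apart to make the final inequality strict; it exists because
    the degree is \<open>Suc m\<close>.\<close>
  also have "\<dots> \<le> 1 * cmod (z m)"
    using z(2) by (intro mult_right_mono prod_le_1) (auto simp: less_imp_le)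
  finally show ?thesis using z(2)[of m] by simp
qed

text \<open>Here \<open>b\<close> lists the coefficients of \<open>R\<close>, of degree
  \<open>m\<close>, padded by \<open>b (Suc m) = 0\<close>. With this padding one formula covers the
  end indices too: \<open>j = 0\<close> gives \<open>a 0 = 1\<close>, and \<open>j = Suc m\<close>
  is trivial.\<close>

definition schur_step :: "nat \<Rightarrow> (nat \<Rightarrow> complex) \<Rightarrow> (nat \<Rightarrow> complex) \<Rightarrow> bool" where
  "schur_step m a b \<longleftrightarrow> b 0 = 1 \<and> b (Suc m) = 0 \<and>
     (\<forall>j\<le>Suc m. a j = b j + a (Suc m) * cnj (b (Suc m - j)))"

lemma schur_stepD:
  assumes "schur_step m a b"
  shows "b 0 = 1" "b (Suc m) = 0" "j \<le> Suc m \<Longrightarrow> a j = b j + a (Suc m) * cnj (b (Suc m - j))"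
  using assms unfolding schur_step_def by blast+

lemma schur_step_0:
  assumes "schur_step m a b"
  shows "a 0 = 1"
  using schur_stepD(3)[OF assms, of 0] schur_stepD(1,2)[OF assms] by simp

lemma schur_step_exists:
  assumes "a 0 = 1" and "cmod (a (Suc m)) < 1"
  shows "\<exists>b. schur_step m a b"
proof -
  define c where "c = a (Suc m)"
  \<comment> \<open>The equation at \<open>j\<close> and the conjugate of the one at
    \<open>Suc m - j\<close> form a linear system in \<open>b j\<close> and
    \<open>cnj (b (Suc m - j))\<close> with determinant \<open>1 - c * cnj c\<close>; this is its
    solution.\<close>
  define b where "b j = (a j - c * cnj (a (Suc m - j))) / (1 - c * cnj c)" for j
  have "cmod (c * cnj c) < 1"
    using assms(2) unfolding c_def complex_mod_mult_cnj by (simp add: abs_square_less_1)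
  then have nz: "1 - c * cnj c \<noteq> 0" by auto
  then have nz': "1 - cnj c * c \<noteq> 0" by (simp add: mult.commute)
  have "a j = b j + c * cnj (b (Suc m - j))" if "j \<le> Suc m" for j
    using nz nz' that by (simp add: b_def divide_simps) (simp add: algebra_simps)
  moreover have "b 0 = 1" "b (Suc m) = 0"
    using nz assms(1) by (simp_all add: b_def c_def)
  ultimately have "schur_step m a b"
    unfolding schur_step_def c_def by blast
  then show ?thesis by blast
qed

lemma desc_poly_schur_step:
  assumes "schur_step m a b"
  shows "desc_poly (Suc m) a x = x * desc_poly m b x + a (Suc m) * conj_rev_poly m b x"
proof -
  have b: "b (Suc m) = 0" and a: "\<And>j. j \<le> Suc m \<Longrightarrow> a j = b j + a (Suc m) * cnj (b (Suc m - j))"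
    using schur_stepD[OF assms] by blast+
  have "desc_poly (Suc m) a x =
      (\<Sum>j\<le>Suc m. (b j + a (Suc m) * cnj (b (Suc m - j))) * x ^ (Suc m - j))"
    unfolding desc_poly_def by (intro sum.cong refl arg_cong2[of _ _ _ _ "(*)"] a) auto
  also have "\<dots> = (\<Sum>j\<le>Suc m. b j * x ^ (Suc m - j)) +
      a (Suc m) * (\<Sum>j\<le>Suc m. cnj (b (Suc m - j)) * x ^ (Suc m - j))"
    by (simp add: ring_distribs sum.distrib sum_distrib_left mult_ac del: sum.atMost_Suc)
  \<comment> \<open>Reversing the summation gives the reversed polynomial; the padding
    \<open>b (Suc m) = 0\<close> removes the surplus term here and in the other sum.\<close>
  also have "(\<Sum>j\<le>Suc m. cnj (b (Suc m - j)) * x ^ (Suc m - j)) = (\<Sum>j\<le>Suc m. cnj (b j) * x ^ j)"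
    using sum.nat_diff_reindex[of "\<lambda>j. cnj (b j) * x ^ j" "Suc (Suc m)"]
    unfolding lessThan_Suc_atMost diff_Suc_Suc .
  also have "\<dots> = conj_rev_poly m b x" by (simp add: conj_rev_poly_def b)
  also have "(\<Sum>j\<le>Suc m. b j * x ^ (Suc m - j)) = x * desc_poly m b x"
    by (auto simp add: b desc_poly_def sum_distrib_left Suc_diff_le intro!: sum.cong)
  finally show ?thesis .
qed

lemma schur_step_schur_stable_iff:
  assumes step: "schur_step m a b" and lt: "cmod (a (Suc m)) < 1"
  shows "schur_stable (Suc m) a \<longleftrightarrow> schur_stable m b"
proof
  assume st: "schur_stable m b"
  show "schur_stable (Suc m) a"
    unfolding schur_stable_def
  proof (intro allI impI notI)
    fix x assume x: "1 \<le> cmod x" and 0: "desc_poly (Suc m) a x = 0"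
    let ?R = "desc_poly m b x"
    have nz: "?R \<noteq> 0" using st x by (auto simp: schur_stable_def)
    \<comment> \<open>At a zero of \<open>P\<close> the two terms balance. With
      \<open>c = a (Suc m)\<close> this gives
      \<open>|x| |R| = |c| |R^*| \<le> |c| |R| < |x| |R|\<close>, the last step since
      \<open>|c| < 1 \<le> |x|\<close> and \<open>R\<close> is nonzero at \<open>x\<close>.\<close>
    have "x * ?R = - (a (Suc m) * conj_rev_poly m b x)"
      using 0 by (simp add: desc_poly_schur_step[OF step] eq_neg_iff_add_eq_0)
    then have "cmod x * cmod ?R = cmod (a (Suc m)) * cmod (conj_rev_poly m b x)"
      by (metis norm_minus_cancel norm_mult)
    also have "\<dots> \<le> cmod (a (Suc m)) * cmod ?R"
      using norm_conj_rev_poly_le[OF schur_stepD(1)[OF step] st x] by (intro mult_left_mono) auto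
    also have "\<dots> < cmod x * cmod ?R"
      using lt x nz by (intro mult_strict_right_mono) auto
    finally show False by simp
  qed
next
  assume st: "schur_stable (Suc m) a"
  show "schur_stable m b"
    unfolding schur_stable_def
  proof (intro allI impI notI)
    fix x assume x: "1 \<le> cmod x" and 0: "desc_poly m b x = 0"
    let ?P = "desc_poly (Suc m) a x" and ?c = "a (Suc m)"
    have x0: "x \<noteq> 0" using x by auto
    have P: "?P = ?c * conj_rev_poly m b x" by (simp add: desc_poly_schur_step[OF step] 0)
    \<comment> \<open>A zero \<open>x\<close> of \<open>R\<close> makes \<open>R^*\<close> vanish at
      the reflected point \<open>1 / cnj x\<close>. There \<open>P\<close> reduces to its first
      term, and reflecting back yields \<open>P^* = R^*\<close> at \<open>x\<close>.\<close>
    have Q: "conj_rev_poly (Suc m) a x = conj_rev_poly m b x"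
    proof -
      have "conj_rev_poly m b (1 / cnj x) = 0"
        using 0 x0 by (simp add: conj_rev_poly_eq)
      then have "desc_poly (Suc m) a (1 / cnj x) = 1 / cnj x * desc_poly m b (1 / cnj x)"
        by (simp add: desc_poly_schur_step[OF step])
      then have "conj_rev_poly (Suc m) a x = x ^ Suc m * cnj (1 / cnj x * desc_poly m b (1 / cnj x))"
        by (simp only: conj_rev_poly_eq[OF x0])
      also have "\<dots> = conj_rev_poly m b x"
        using x0 by (simp add: conj_rev_poly_eq[of x m b])
      finally show ?thesis .
    qed
    \<comment> \<open>Now \<open>|P| = |c| |R^*| < |R^*| = |P^*|\<close>, whereas stability of
      \<open>P\<close> gives \<open>|P^*| \<le> |P|\<close>.\<close>
    have nz: "?P \<noteq> 0" using st x by (auto simp: schur_stable_def)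
    then have "cmod (conj_rev_poly m b x) > 0" using P by auto
    then have "cmod ?P < cmod (conj_rev_poly m b x)" using lt by (simp add: P norm_mult)
    moreover have "cmod (conj_rev_poly m b x) \<le> cmod ?P"
      using norm_conj_rev_poly_le[OF schur_step_0[OF step] st x] Q by simp
    ultimately show False by simp
  qed
qed

section \<open>The Schur-Cohn form\<close>

text \<open>Coordinate \<open>j\<close> of \<open>c(S) v\<close>, where \<open>S\<close> moves
  \<open>v (j + 1)\<close> to place \<open>j\<close> and \<open>v\<close> is cut off at
  \<open>n\<close>: an upper triangular Toeplitz matrix applied to \<open>v\<close>.\<close>

definition toeplitz_app :: "nat \<Rightarrow> (nat \<Rightarrow> complex) \<Rightarrow> (nat \<Rightarrow> complex) \<Rightarrow> nat \<Rightarrow> complex" where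
  "toeplitz_app n c v j = (\<Sum>l\<in>{j..<n}. c (l - j) * v l)"

text \<open>Vectors are functions on \<open>nat\<close>, so the tail used in the induction is simply
  \<open>\<lambda>i. v (Suc i)\<close>.\<close>

definition schur_form :: "nat \<Rightarrow> (nat \<Rightarrow> complex) \<Rightarrow> (nat \<Rightarrow> complex) \<Rightarrow> real" where
  "schur_form n a v = (\<Sum>j<n. (cmod (toeplitz_app n a v j))\<^sup>2)
     - (\<Sum>j<n. (cmod (toeplitz_app n (\<lambda>i. cnj (a (n - i))) v j))\<^sup>2)"

definition schur_form_pos :: "nat \<Rightarrow> (nat \<Rightarrow> complex) \<Rightarrow> bool" where
  "schur_form_pos n a \<longleftrightarrow> (\<forall>v. (\<exists>i<n. v i \<noteq> 0) \<longrightarrow> 0 < schur_form n a v)"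

text \<open>The matrix with rows \<open>(1, c)\<close> and \<open>(cnj c, 1)\<close> scales the
  indefinite form \<open>|X|^2 - |Y|^2\<close> by its determinant, because the cross terms
  cancel.\<close>

lemma norm_diff_of_combination:
  "(cmod (X + c * Y))\<^sup>2 - (cmod (Y + cnj c * X))\<^sup>2 = (1 - (cmod c)\<^sup>2) * ((cmod X)\<^sup>2 - (cmod Y)\<^sup>2)"
  by (simp add: cmod_power2) (simp add: power2_eq_square algebra_simps)

lemma toeplitz_app_Suc:
  "toeplitz_app (Suc n) c v (Suc j) = toeplitz_app n c (\<lambda>i. v (Suc i)) j"
  unfolding toeplitz_app_def by (subst sum.shift_bounds_Suc_ivl) simp

text \<open>With \<open>c 0 = 0\<close> a factor \<open>S\<close> splits off from
  \<open>c(S)\<close>; applying it to \<open>v\<close> first leaves the tail. At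
  \<open>j = n\<close> both sides are zero.\<close>

lemma toeplitz_app_shift:
  assumes "c 0 = 0" and "j \<le> n"
  shows "toeplitz_app (Suc n) c v j = toeplitz_app n (\<lambda>i. c (Suc i)) (\<lambda>i. v (Suc i)) j"
proof -
  have "toeplitz_app (Suc n) c v j = (\<Sum>l\<in>{Suc j..<Suc n}. c (l - j) * v l)"
    unfolding toeplitz_app_def using assms by (subst sum.atLeast_Suc_lessThan) auto
  also have "\<dots> = (\<Sum>l\<in>{j..<n}. c (Suc (l - j)) * v (Suc l))"
    by (subst sum.shift_bounds_Suc_ivl) (simp add: Suc_diff_le)
  finally show ?thesis by (simp add: toeplitz_app_def)
qed

lemma schur_form_step:
  assumes step: "schur_step m a b"
  shows "schur_form (Suc m) a v = (1 - (cmod (a (Suc m)))\<^sup>2) *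
    ((cmod (v 0 + (\<Sum>l<m. b (Suc l) * v (Suc l))))\<^sup>2 + schur_form m b (\<lambda>i. v (Suc i)))"
proof -
  define c where "c = a (Suc m)"
  define X where "X = toeplitz_app (Suc m) b v"
  define Y where "Y = toeplitz_app (Suc m) (\<lambda>i. cnj (b (Suc m - i))) v"
  let ?w = "\<lambda>i. v (Suc i)"
  have b: "b 0 = 1" "b (Suc m) = 0"
    and a: "\<And>j. j \<le> Suc m \<Longrightarrow> a j = b j + c * cnj (b (Suc m - j))"
    unfolding c_def using schur_stepD[OF step] by blast+
  \<comment> \<open>\<open>A\<close> and \<open>B\<close> express both Toeplitz images for
    \<open>a\<close> through those for the padded \<open>b\<close>, in the shape that
    \<open>norm_diff_of_combination\<close> needs in each coordinate.\<close>
  have A: "toeplitz_app (Suc m) a v j = X j + c * Y j" for j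
  proof -
    have "toeplitz_app (Suc m) a v j =
        (\<Sum>l\<in>{j..<Suc m}. (b (l - j) + c * cnj (b (Suc m - (l - j)))) * v l)"
      unfolding toeplitz_app_def by (intro sum.cong refl arg_cong2[of _ _ _ _ "(*)"] a) auto
    then show ?thesis
      by (simp add: X_def Y_def toeplitz_app_def ring_distribs sum.distrib sum_distrib_left mult.assoc
          del: sum.op_ivl_Suc)
  qed
  have B: "toeplitz_app (Suc m) (\<lambda>i. cnj (a (Suc m - i))) v j = Y j + cnj c * X j" for j
  proof -
    have "toeplitz_app (Suc m) (\<lambda>i. cnj (a (Suc m - i))) v j =
        (\<Sum>l\<in>{j..<Suc m}. (cnj (b (Suc m - (l - j))) + cnj c * b (l - j)) * v l)"
      unfolding toeplitz_app_def
    proof (intro sum.cong refl arg_cong2[of _ _ _ _ "(*)"])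
      fix l assume "l \<in> {j..<Suc m}"
      then have "Suc m - (Suc m - (l - j)) = l - j" by simp
      then show "cnj (a (Suc m - (l - j))) = cnj (b (Suc m - (l - j))) + cnj c * b (l - j)"
        by (subst a) auto
    qed
    then show ?thesis
      by (simp add: X_def Y_def toeplitz_app_def ring_distribs sum.distrib sum_distrib_left mult.assoc
          del: sum.op_ivl_Suc)
  qed
  \<comment> \<open>Passing to length \<open>m\<close>, \<open>X\<close> has one extra leading
    coordinate, which supplies the separate square, while \<open>Y\<close> has one extra trailing
    coordinate, which is zero because its symbol starts with
    \<open>cnj (b (Suc m)) = 0\<close>.\<close>
  have X0: "X 0 = v 0 + (\<Sum>l<m. b (Suc l) * v (Suc l))"
    by (simp add: X_def toeplitz_app_def atLeast0LessThan sum.lessThan_Suc_shift b del: sum.lessThan_Suc)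
  have XS: "X (Suc j) = toeplitz_app m b ?w j" for j
    by (simp add: X_def toeplitz_app_Suc)
  have YS: "Y j = toeplitz_app m (\<lambda>i. cnj (b (m - i))) ?w j" if "j \<le> m" for j
    using that b by (simp add: Y_def toeplitz_app_shift)
  have Ym: "Y m = 0" by (simp add: YS) (simp add: toeplitz_app_def)
  have "schur_form (Suc m) a v = (\<Sum>j<Suc m. (1 - (cmod c)\<^sup>2) * ((cmod (X j))\<^sup>2 - (cmod (Y j))\<^sup>2))"
    unfolding schur_form_def A B sum_subtractf[symmetric] norm_diff_of_combination ..
  also have "\<dots> = (1 - (cmod c)\<^sup>2) * ((\<Sum>j<Suc m. (cmod (X j))\<^sup>2) - (\<Sum>j<Suc m. (cmod (Y j))\<^sup>2))"
    by (simp only: sum_subtractf flip: sum_distrib_left)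
  also have "(\<Sum>j<Suc m. (cmod (X j))\<^sup>2) = (cmod (X 0))\<^sup>2 + (\<Sum>j<m. (cmod (toeplitz_app m b ?w j))\<^sup>2)"
    by (simp only: sum.lessThan_Suc_shift XS)
  also have "(\<Sum>j<Suc m. (cmod (Y j))\<^sup>2) =
      (\<Sum>j<m. (cmod (toeplitz_app m (\<lambda>i. cnj (b (m - i))) ?w j))\<^sup>2)"
    unfolding sum.lessThan_Suc Ym by (simp add: YS)
  finally show ?thesis
    by (simp add: X0 schur_form_def c_def algebra_simps)
qed

lemma schur_form_pos_last:
  assumes "a 0 = 1" "schur_form_pos (Suc m) a"
  shows "cmod (a (Suc m)) < 1"
proof -
  \<comment> \<open>On the first unit vector each Toeplitz image has only coordinate 0, equal to the
    leading symbol coefficient; the form evaluates to the corner entry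
    \<open>1 - |a_n|^2\<close>.\<close>
  define v :: "nat \<Rightarrow> complex" where "v i = (if i = 0 then 1 else 0)" for i
  have *: "toeplitz_app (Suc m) c v j = (if j = 0 then c 0 else 0)" for c j
  proof -
    have "toeplitz_app (Suc m) c v j = (\<Sum>l\<in>{j..<Suc m}. if l = 0 then c (l - j) else 0)"
      unfolding toeplitz_app_def by (intro sum.cong) (auto simp: v_def)
    then show ?thesis by (simp del: sum.op_ivl_Suc)
  qed
  have "schur_form (Suc m) a v = 1 - (cmod (a (Suc m)))\<^sup>2"
    unfolding schur_form_def * sum.lessThan_Suc_shift using assms(1) by simp
  moreover have "0 < schur_form (Suc m) a v"
    using assms(2) unfolding schur_form_pos_def by (auto simp: v_def)
  ultimately show ?thesis using abs_square_less_1[of "cmod (a (Suc m))"] by simp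
qed

lemma schur_step_schur_form_pos_iff:
  assumes step: "schur_step m a b" and lt: "cmod (a (Suc m)) < 1"
  shows "schur_form_pos (Suc m) a \<longleftrightarrow> schur_form_pos m b"
proof -
  have pos: "0 < 1 - (cmod (a (Suc m)))\<^sup>2" using lt by (simp add: abs_square_less_1)
  show ?thesis
  proof
    assume A: "schur_form_pos (Suc m) a"
    show "schur_form_pos m b"
      unfolding schur_form_pos_def
    proof (intro allI impI)
      fix w :: "nat \<Rightarrow> complex" assume "\<exists>i<m. w i \<noteq> 0"
      \<comment> \<open>The first coordinate is chosen to annihilate the square in
        \<open>schur_form_step\<close>, leaving a positive multiple of the form of \<open>b\<close>
        at \<open>w\<close>.\<close>
      define v where "v = case_nat (- (\<Sum>l<m. b (Suc l) * w l)) w"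
      have "\<exists>i<Suc m. v i \<noteq> 0" using \<open>\<exists>i<m. w i \<noteq> 0\<close> by (auto simp: v_def)
      then have "0 < schur_form (Suc m) a v" using A by (auto simp: schur_form_pos_def)
      also have "\<dots> = (1 - (cmod (a (Suc m)))\<^sup>2) * schur_form m b w"
        by (simp add: schur_form_step[OF step] v_def)
      finally show "0 < schur_form m b w" using pos by (simp add: zero_less_mult_iff)
    qed
  next
    assume B: "schur_form_pos m b"
    show "schur_form_pos (Suc m) a"
      unfolding schur_form_pos_def
    proof (intro allI impI)
      fix v :: "nat \<Rightarrow> complex" assume ex: "\<exists>i<Suc m. v i \<noteq> 0"
      let ?w = "\<lambda>i. v (Suc i)"
      have "0 < (cmod (v 0 + (\<Sum>l<m. b (Suc l) * v (Suc l))))\<^sup>2 + schur_form m b ?w"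
      proof (cases "\<exists>i<m. ?w i \<noteq> 0")
        case True
        with B[unfolded schur_form_pos_def, THEN spec[of _ ?w]] have "0 < schur_form m b ?w" by (rule mp)
        then show ?thesis by (rule add_nonneg_pos[OF zero_le_power2])
      next
        case False
        \<comment> \<open>If the tail vanishes, the form of \<open>b\<close> contributes zero and
          the square is \<open>|v 0|^2 > 0\<close>.\<close>
        then have "v 0 \<noteq> 0" using ex less_Suc_eq_0_disj by auto
        moreover have "toeplitz_app m c ?w j = 0" for c j
          using False by (auto simp: toeplitz_app_def intro: sum.neutral)
        ultimately show ?thesis using False by (simp add: schur_form_def)
      qed
      then show "0 < schur_form (Suc m) a v" using pos by (simp add: schur_form_step[OF step])
    qed
  qed
qed

lemma schur_stable_iff_schur_form_pos:
  "a 0 = 1 \<Longrightarrow> schur_stable n a \<longleftrightarrow> schur_form_pos n a"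
proof (induction n arbitrary: a)
  case 0
  then show ?case by (simp add: schur_stable_def desc_poly_def schur_form_pos_def)
next
  case (Suc m)
  show ?case
  proof (cases "cmod (a (Suc m)) < 1")
    case True
    then obtain b where "schur_step m a b" using schur_step_exists Suc.prems by blast
    then show ?thesis
      using Suc.IH[of b] True by (simp add: schur_step_schur_stable_iff schur_step_schur_form_pos_iff schur_stepD(1))
  next
    case False
    \<comment> \<open>Without \<open>|a_n| < 1\<close> there is no reduction step to use, but each
      side of the equivalence forces that bound, so both are false.\<close>
    then show ?thesis using schur_stable_last schur_form_pos_last Suc.prems by blast
  qed
qed

section \<open>The Schur-Cohn matrix\<close>

text \<open>The squared norm of \<open>c(S) v\<close> is the quadratic form of the Gram matrix of
  \<open>c(S)\<close>, whose entries are the inner sums.\<close>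

lemma toeplitz_app_norm_sum:
  "complex_of_real (\<Sum>j<n. (cmod (toeplitz_app n c v j))\<^sup>2) =
    (\<Sum>k<n. \<Sum>l<n. (\<Sum>j\<le>min k l. cnj (c (k - j)) * c (l - j)) * v l * cnj (v k))"
proof -
  \<comment> \<open>Padding the triangular matrix by zeros makes all sums run over the full range,
    so they can be interchanged; at the end only \<open>j \<le> min k l\<close> survives.\<close>
  define d where "d j l = (if j \<le> l then c (l - j) else 0)" for j l
  have T: "toeplitz_app n c v j = (\<Sum>l<n. d j l * v l)" for j
  proof -
    have "(\<Sum>l<n. d j l * v l) = (\<Sum>l\<in>{j..<n}. d j l * v l)"
      by (rule sum.mono_neutral_right) (auto simp: d_def)
    then show ?thesis by (simp add: toeplitz_app_def d_def)
  qed
  have "complex_of_real (\<Sum>j<n. (cmod (toeplitz_app n c v j))\<^sup>2) =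
      (\<Sum>j<n. (\<Sum>k<n. cnj (d j k * v k)) * (\<Sum>l<n. d j l * v l))"
    by (simp only: T of_real_sum complex_norm_square cnj_sum mult.commute)
  also have "\<dots> = (\<Sum>j<n. \<Sum>k<n. \<Sum>l<n. cnj (d j k) * d j l * v l * cnj (v k))"
    by (simp only: sum_product) (simp add: mult_ac)
  also have "\<dots> = (\<Sum>k<n. \<Sum>j<n. \<Sum>l<n. cnj (d j k) * d j l * v l * cnj (v k))"
    by (rule sum.swap)
  also have "\<dots> = (\<Sum>k<n. \<Sum>l<n. \<Sum>j<n. cnj (d j k) * d j l * v l * cnj (v k))"
    by (rule sum.cong[OF refl], rule sum.swap)
  also have "\<dots> = (\<Sum>k<n. \<Sum>l<n. (\<Sum>j\<le>min k l. cnj (c (k - j)) * c (l - j)) * v l * cnj (v k))"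
  proof (intro sum.cong refl)
    fix k l assume "k \<in> {..<n}" "l \<in> {..<n}"
    then have "(\<Sum>j<n. cnj (d j k) * d j l) = (\<Sum>j\<le>min k l. cnj (d j k) * d j l)"
      by (intro sum.mono_neutral_right) (auto simp: d_def)
    then show "(\<Sum>j<n. cnj (d j k) * d j l * v l * cnj (v k)) =
        (\<Sum>j\<le>min k l. cnj (c (k - j)) * c (l - j)) * v l * cnj (v k)"
      by (simp add: d_def flip: sum_distrib_right)
  qed
  finally show ?thesis .
qed

text \<open>In 0-based indices the entry is a difference of two Gram entries, for the symbols
  \<open>a_i\<close> and \<open>cnj (a_{n-i})\<close>, ready for
  \<open>toeplitz_app_norm_sum\<close>.\<close>

lemma schur_cohn_entry_Suc:
  assumes "k < n" "l < n"
  shows "schur_cohn_entry n s p (Suc k) (Suc l) =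
    (\<Sum>j\<le>min k l. cnj (signed_coeff n s p (k - j)) * signed_coeff n s p (l - j)) -
    (\<Sum>j\<le>min k l. signed_coeff n s p (n - (k - j)) * cnj (signed_coeff n s p (n - (l - j))))"
proof -
  have "{1..min (Suc k) (Suc l)} = Suc ` {..min k l}"
    by (simp add: image_Suc_atMost)
  then have "schur_cohn_entry n s p (Suc k) (Suc l) =
      (\<Sum>j\<le>min k l. cnj (signed_coeff n s p (k - j)) * signed_coeff n s p (l - j)
        - signed_coeff n s p (n - Suc k + Suc j) * cnj (signed_coeff n s p (n - Suc l + Suc j)))"
    by (simp add: schur_cohn_entry_def Let_def sum.reindex)
  also have "\<dots> = (\<Sum>j\<le>min k l. cnj (signed_coeff n s p (k - j)) * signed_coeff n s p (l - j)
        - signed_coeff n s p (n - (k - j)) * cnj (signed_coeff n s p (n - (l - j))))"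
  proof (rule sum.cong[OF refl])
    fix j assume "j \<in> {..min k l}"
    \<comment> \<open>No truncation occurs in these natural subtractions, since
      \<open>j \<le> k < n\<close> and \<open>j \<le> l < n\<close>.\<close>
    then have "n - Suc k + Suc j = n - (k - j)" "n - Suc l + Suc j = n - (l - j)"
      using assms by auto
    then show "cnj (signed_coeff n s p (k - j)) * signed_coeff n s p (l - j)
          - signed_coeff n s p (n - Suc k + Suc j) * cnj (signed_coeff n s p (n - Suc l + Suc j)) =
        cnj (signed_coeff n s p (k - j)) * signed_coeff n s p (l - j)
          - signed_coeff n s p (n - (k - j)) * cnj (signed_coeff n s p (n - (l - j)))"
      by (simp only:)
  qed
  finally show ?thesis by (simp add: sum_subtractf)
qed

lemma schur_cohn_mat_quadratic_form:
  assumes "v \<in> carrier_vec n"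
  shows "(schur_cohn_mat n s p *\<^sub>v v) \<bullet>c v = complex_of_real (schur_form n (signed_coeff n s p) (($) v))"
proof -
  have "(schur_cohn_mat n s p *\<^sub>v v) \<bullet>c v =
      (\<Sum>k<n. \<Sum>l<n. schur_cohn_entry n s p (Suc k) (Suc l) * v $ l * cnj (v $ k))"
    using assms
    by (auto simp: scalar_prod_def schur_cohn_mat_def atLeast0LessThan sum_distrib_right intro!: sum.cong)
  also have "\<dots> = complex_of_real (schur_form n (signed_coeff n s p) (($) v))"
    unfolding schur_form_def of_real_diff toeplitz_app_norm_sum
    unfolding sum_subtractf[symmetric]
    by (intro sum.cong refl) (simp add: schur_cohn_entry_Suc ring_distribs)
  finally show ?thesis .
qed

lemma pos_def_schur_cohn_mat_iff:
  "pos_def_mat n (schur_cohn_mat n s p) \<longleftrightarrow> schur_form_pos n (signed_coeff n s p)"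
proof
  assume L: "pos_def_mat n (schur_cohn_mat n s p)"
  show "schur_form_pos n (signed_coeff n s p)"
    unfolding schur_form_pos_def
  proof (intro allI impI)
    fix v :: "nat \<Rightarrow> complex" assume "\<exists>i<n. v i \<noteq> 0"
    define w where "w = Matrix.vec n v"
    have w: "w \<in> carrier_vec n" "w \<noteq> 0\<^sub>v n"
      using \<open>\<exists>i<n. v i \<noteq> 0\<close> by (auto simp: w_def vec_eq_iff)
    then have "0 < (schur_cohn_mat n s p *\<^sub>v w) \<bullet>c w"
      using L by (auto simp: pos_def_mat_def)
    then have "0 < schur_form n (signed_coeff n s p) (($) w)"
      by (simp add: schur_cohn_mat_quadratic_form[OF w(1)] less_complex_def)
    also have "toeplitz_app n c (($) w) = toeplitz_app n c v" for c
      by (auto simp: toeplitz_app_def w_def fun_eq_iff intro!: sum.cong)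
    then have "schur_form n (signed_coeff n s p) (($) w) = schur_form n (signed_coeff n s p) v"
      by (simp add: schur_form_def)
    finally show "0 < schur_form n (signed_coeff n s p) v" .
  qed
next
  assume R: "schur_form_pos n (signed_coeff n s p)"
  have "0 < (schur_cohn_mat n s p *\<^sub>v v) \<bullet>c v" if v: "v \<in> carrier_vec n" "v \<noteq> 0\<^sub>v n" for v
  proof -
    have "\<exists>i<n. v $ i \<noteq> 0" using v by (auto simp: vec_eq_iff)
    then have "0 < schur_form n (signed_coeff n s p) (($) v)"
      using R by (auto simp: schur_form_pos_def)
    then show ?thesis by (simp add: schur_cohn_mat_quadratic_form[OF v(1)] less_complex_def)
  qed
  moreover have "schur_cohn_mat n s p \<in> carrier_mat n n" by (simp add: schur_cohn_mat_def)
  ultimately show "pos_def_mat n (schur_cohn_mat n s p)"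
    by (simp add: pos_def_mat_def schur_cohn_mat_hermitian)
qed

section \<open>From coefficient sequences back to the coordinates \<open>s\<close> and
  \<open>\<beta>\<close>\<close>

lemma schur_step_of_sym_coords:
  assumes a: "a = signed_coeff (Suc m) s p"
    and b: "b = (\<lambda>j. if j = 0 then 1 else if j = Suc m then 0 else (-1) ^ j * \<beta> $ (j - 1))"
  shows "schur_step m a b \<longleftrightarrow> (\<forall>j\<in>{1..m}. s $ (j - 1) = \<beta> $ (j - 1) + cnj (\<beta> $ (m - j)) * p)"
proof -
  have "a j = b j + a (Suc m) * cnj (b (Suc m - j)) \<longleftrightarrow>
      s $ (j - 1) = \<beta> $ (j - 1) + cnj (\<beta> $ (m - j)) * p" if j: "j \<in> {1..m}" for j
  proof -
    \<comment> \<open>The signs of \<open>p\<close> and of \<open>\<beta>_{n-j}\<close> combine to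
      the common sign of \<open>s_j\<close> and \<open>\<beta>_j\<close>, which then cancels. As
      \<open>n = Suc m\<close>, the 0-based position of \<open>\<beta>_{n-j}\<close> is
      \<open>m - j\<close>.\<close>
    have "(-1 :: complex) ^ Suc m * (-1) ^ (Suc m - j) = (-1) ^ j"
    proof -
      have "(-1 :: complex) ^ Suc m = (-1) ^ j * (-1) ^ (Suc m - j)"
        using j by (simp flip: power_add)
      then show ?thesis by (simp add: mult.assoc flip: power_mult_distrib)
    qed
    moreover have "a (Suc m) * cnj (b (Suc m - j)) =
        ((-1) ^ Suc m * (-1) ^ (Suc m - j)) * (cnj (\<beta> $ (m - j)) * p)"
      using j by (auto simp: a b signed_coeff_def mult_ac)
    ultimately have "a (Suc m) * cnj (b (Suc m - j)) = (-1) ^ j * (cnj (\<beta> $ (m - j)) * p)"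
      by (simp only:)
    moreover have "a j = (-1) ^ j * s $ (j - 1)" "b j = (-1) ^ j * \<beta> $ (j - 1)"
      using j by (auto simp: a b signed_coeff_def)
    ultimately show ?thesis by (simp flip: distrib_left)
  qed
  \<comment> \<open>The equations at the two end indices hold by the definitions of \<open>a\<close>
    and \<open>b\<close>.\<close>
  moreover have "{..Suc m} = insert 0 (insert (Suc m) {1..m})" by auto
  then have "(\<forall>j\<le>Suc m. a j = b j + a (Suc m) * cnj (b (Suc m - j))) \<longleftrightarrow>
      (\<forall>j\<in>{1..m}. a j = b j + a (Suc m) * cnj (b (Suc m - j)))"
    unfolding Ball_def atMost_iff[symmetric] by (auto simp: a b signed_coeff_def)
  ultimately show ?thesis by (simp add: schur_step_def b)
qed

theorem theorem3p2:
  fixes n :: nat and s :: "complex Matrix.vec" and p :: complex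
  assumes "n \<ge> 2"
    and "s \<in> carrier_vec (n - 1)"
    and "cmod p < 1"
  shows "(s @\<^sub>v vCons p vNil \<in> \<G> n \<longleftrightarrow>
      (\<exists>\<beta> \<in> \<G> (n - 1). \<forall>j \<in> {1..n - 1}. s $ (j - 1) = \<beta> $ (j - 1) + cnj (\<beta> $ (n - j - 1)) * p))
    \<and> (s @\<^sub>v vCons p vNil \<in> \<G> n \<longleftrightarrow> pos_def_mat n (schur_cohn_mat n s p))"
proof -
  obtain m where n: "n = Suc m" using assms(1) by (cases n) auto
  then have nm: "n - 1 = m" by simp
  define a where "a = signed_coeff n s p"
  \<comment> \<open>The candidate \<open>R\<close> for a point \<open>\<beta>\<close>: its signed
    coordinates, made monic at index 0 and padded by zero at \<open>Suc m\<close> as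
    \<open>schur_step\<close> requires.\<close>
  define cf where "cf \<beta> j = (if j = 0 then 1 else if j = Suc m then 0 else (-1) ^ j * \<beta> $ (j - 1))"
    for \<beta> :: "complex Matrix.vec" and j
  have a0: "a 0 = 1" by (simp add: a_def signed_coeff_def)
  have lt: "cmod (a (Suc m)) < 1"
    using assms(3) by (simp add: a_def signed_coeff_def n norm_mult norm_power)
  have i: "s @\<^sub>v vCons p vNil \<in> \<G> n \<longleftrightarrow> schur_stable n a"
  proof (rule mem_sym_polydisc_iff)
    have dim: "dim_vec s = m" using assms(2) n by simp
    show "s @\<^sub>v vCons p vNil \<in> carrier_vec n"
      using dim by (intro carrier_vecI) (simp add: n)
    show "a 0 = 1" by (fact a0)
    show "a (Suc j) = (-1) ^ Suc j * (s @\<^sub>v vCons p vNil) $ j" if "j < n" for j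
      using that dim by (auto simp: a_def signed_coeff_def n)
  qed
  have step: "schur_step m a (cf \<beta>) \<longleftrightarrow>
      (\<forall>j\<in>{1..n - 1}. s $ (j - 1) = \<beta> $ (j - 1) + cnj (\<beta> $ (n - j - 1)) * p)" for \<beta>
    using schur_step_of_sym_coords[of a m s p "cf \<beta>" \<beta>] by (simp add: a_def n cf_def fun_eq_iff)
  have mem: "\<beta> \<in> \<G> m \<longleftrightarrow> schur_stable m (cf \<beta>)" if "\<beta> \<in> carrier_vec m" for \<beta>
    using that by (rule mem_sym_polydisc_iff) (auto simp: cf_def)
  have ii: "schur_stable n a \<longleftrightarrow> (\<exists>\<beta>\<in>\<G> (n - 1). schur_step m a (cf \<beta>))"
    unfolding nm
  proof
    assume st: "schur_stable n a"
    obtain b where b: "schur_step m a b" using schur_step_exists[of a m] a0 lt by blast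
    \<comment> \<open>Removing the signs from the reduced coefficients recovers the point;
      \<open>cf \<beta>\<close> then agrees with \<open>b\<close> at every index that
      \<open>schur_step\<close> reads.\<close>
    define \<beta> where "\<beta> = Matrix.vec m (\<lambda>j. (-1) ^ Suc j * b (Suc j))"
    have eq: "cf \<beta> j = b j" if "j \<le> Suc m" for j
      using that schur_stepD(1,2)[OF b] by (cases j) (auto simp: cf_def \<beta>_def simp flip: mult.assoc power_mult_distrib)
    have "a j = cf \<beta> j + a (Suc m) * cnj (cf \<beta> (Suc m - j))" if "j \<le> Suc m" for j
      using schur_stepD(3)[OF b that] by (simp only: eq that diff_le_self)
    moreover have "cf \<beta> 0 = 1" "cf \<beta> (Suc m) = 0" by (simp_all add: cf_def)
    ultimately have step\<beta>: "schur_step m a (cf \<beta>)" unfolding schur_step_def by blast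
    have "\<beta> \<in> \<G> m"
      using mem[of \<beta>] st schur_step_schur_stable_iff[OF step\<beta> lt] by (simp add: n \<beta>_def)
    with step\<beta> show "\<exists>\<beta>\<in>\<G> m. schur_step m a (cf \<beta>)" by blast
  next
    assume "\<exists>\<beta>\<in>\<G> m. schur_step m a (cf \<beta>)"
    then obtain \<beta> where \<beta>: "\<beta> \<in> \<G> m" "schur_step m a (cf \<beta>)" by blast
    then have "\<beta> \<in> carrier_vec m" by (auto simp: sym_polydisc_def symmetrization_def)
    with \<beta> show "schur_stable n a" using mem schur_step_schur_stable_iff lt by (auto simp: n)
  qed
  have iii: "schur_stable n a \<longleftrightarrow> pos_def_mat n (schur_cohn_mat n s p)"
    unfolding pos_def_schur_cohn_mat_iff a_def[symmetric]
    by (rule schur_stable_iff_schur_form_pos[of a n, OF a0])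
  show ?thesis
    using ii[unfolded step] iii unfolding i by (rule conjI)
qed

end
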